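(* Fix positive integers $r,s$. Let $\sigma=(x,y,z)$ and $\sigma'=(x',y',z')$ be states in $\mathbf{Rec}$ that are congruent, i.e. $x\equiv x'\pmod r$ and $y\equiv y'\pmod s$. Then $\sigma$ and $\sigma'$ lie in the same orbit of $f_{r,s}$ (i.e. $f_{r,s}^k(\sigma)=\sigma'$ or $f_{r,s}^k(\sigma')=\sigma$ for some integer $k\ge0$) if and only if $g_{r,s}(\sigma)=g_{r,s}(\sigma')$.
   Context: Fix positive integers $r,s$. In the one-dimensional generalized rotor-router model, a particle starts at $0$, at each occupied site moves left if the label there is $L$ and right if it is $R$, then flips that label; on first reaching an unoccupied site to the left (resp. right) of the occupied interval, $r$ (resp. $s$) new consecutive sites on that side become occupied, labeled $R$; this defines the map $f_{r,s}$. The recurrent states $\mathbf{Rec}$ are identified with integer triples $(x,y,z)$, $x\le0\le y$, $x\le z\le y$ (the state with occupied interval $[x,y+s-1]$, labels $R$ on $[x,z-1]$, $L$ on $[z,y-1]$, $R$ on $[y,y+s-1]$); on them $f_{r,s}(x,y,z)=(x,y+s,z-y)$ if $x+y\le z$ and $f_{r,s}(x,y,z)=(x-r,y,z-x+1)$ if $x+y>z$. Also $g_{r,s}(x,y,z)=sx^2-ry^2+(r-2)sx+rsy-2rsz$. *)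

theory Defs
  imports "HOL-Number_Theory.Cong"
begin

datatype label = L | R

text \<open>A state assigns a label to every occupied site; unoccupied sites are mapped to
  \<^const>\<open>None\<close>.\<close>

type_synonym state = "int \<Rightarrow> label option"

text \<open>\<open>run \<sigma> p\<close> lets a particle that is at site \<open>p\<close> move until it first stands on an unoccupied
  site, and returns the resulting labels together with that site.\<close>

partial_function (tailrec) run :: "state \<Rightarrow> int \<Rightarrow> state \<times> int" where
  "run \<sigma> p =
    (case \<sigma> p of
       None \<Rightarrow> (\<sigma>, p)
     | Some l \<Rightarrow>
         (case l of
            L \<Rightarrow> run (\<sigma>(p := Some R)) (p - 1)
          | R \<Rightarrow> run (\<sigma>(p := Some L)) (p + 1)))"

definition occupy :: "int set \<Rightarrow> state \<Rightarrow> state" where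
  "occupy A \<sigma> = (\<lambda>q. if q \<in> A then Some R else \<sigma> q)"

definition rotor_map :: "int \<Rightarrow> int \<Rightarrow> state \<Rightarrow> state" where
  "rotor_map r s \<sigma> =
    (let (\<tau>, p) = run \<sigma> 0
     in if \<forall>q\<in>dom \<tau>. q < p then occupy {p..p + s - 1} \<tau> else occupy {p - r + 1..p} \<tau>)"

text \<open>Recurrent states are identified with the triples in \<open>Rec\<close>; \<open>state_of s\<close> is the state that
  a triple stands for.\<close>

definition Rec :: "(int \<times> int \<times> int) set" where
  "Rec = {(x, y, z). x \<le> 0 \<and> 0 \<le> y \<and> x \<le> z \<and> z \<le> y}"

fun state_of :: "int \<Rightarrow> int \<times> int \<times> int \<Rightarrow> state" where
  "state_of s (x, y, z) =
    (\<lambda>q. if q \<in> {x..z - 1} then Some R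
         else if q \<in> {z..y - 1} then Some L
         else if q \<in> {y..y + s - 1} then Some R
         else None)"

fun g :: "int \<Rightarrow> int \<Rightarrow> int \<times> int \<times> int \<Rightarrow> int" where
  "g r s (x, y, z) = s * x\<^sup>2 - r * y\<^sup>2 + (r - 2) * s * x + r * s * y - 2 * r * s * z"

end

theory Submission
  imports Defs
begin

text \<open>The quantity \<open>g\<close> and the residues of \<open>x\<close> modulo \<open>r\<close> and of \<open>y\<close> modulo \<open>s\<close> are invariant, and
  together with \<open>x\<close> and \<open>y\<close> the value of \<open>g\<close> determines \<open>z\<close>. For fixed \<open>g\<close>, \<open>2 * r * s * z\<close>
  has the form \<open>A x - B y\<close>, where \<open>A\<close> increases as \<open>x\<close> decreases by steps of \<open>r\<close> and \<open>B\<close> increases as \<open>y\<close> grows by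
  steps of \<open>s\<close>; the condition \<open>x \<le> z \<le> y\<close> says that \<open>A x \<le> B (y + s)\<close> and \<open>B y < A (x - r)\<close>.
  Hence of two congruent recurrent states with the same \<open>g\<close> one has the larger occupied interval on
  both sides, and iterating the map from the other one can never overshoot it.\<close>

section \<open>The map on triples\<close>

text \<open>Lets a whole block be crossed at once; an excursion is this sweep followed by the one in
  \<open>run_left\<close>.\<close>

lemma run_right:
  assumes "p \<le> q" and "\<And>i. p \<le> i \<Longrightarrow> i < q \<Longrightarrow> \<sigma> i = Some R"
  shows "run \<sigma> p = run (\<lambda>i. if i \<in> {p..<q} then Some L else \<sigma> i) q"
  using assms
proof (induction "nat (q - p)" arbitrary: \<sigma> p)
  case 0
  then have "(\<lambda>i. if i \<in> {p..<q} then Some L else \<sigma> i) = \<sigma>" and "p = q" by auto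
  then show ?case by simp
next
  case (Suc n)
  then have "p < q" by auto
  then have "run \<sigma> p = run (\<sigma>(p := Some L)) (p + 1)"
    using Suc.prems by (subst run.simps) simp
  also have "\<dots> = run (\<lambda>i. if i \<in> {p + 1..<q} then Some L else (\<sigma>(p := Some L)) i) q"
    using Suc \<open>p < q\<close> by (intro Suc.hyps(1)) auto
  also have "(\<lambda>i. if i \<in> {p + 1..<q} then Some L else (\<sigma>(p := Some L)) i)
      = (\<lambda>i. if i \<in> {p..<q} then Some L else \<sigma> i)"
    using \<open>p < q\<close> by auto
  finally show ?case .
qed

lemma run_left:
  assumes "q \<le> p" and "\<And>i. q < i \<Longrightarrow> i \<le> p \<Longrightarrow> \<sigma> i = Some L"
  shows "run \<sigma> p = run (\<lambda>i. if i \<in> {q<..p} then Some R else \<sigma> i) q"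
  using assms
proof (induction "nat (p - q)" arbitrary: \<sigma> p)
  case 0
  then have "(\<lambda>i. if i \<in> {q<..p} then Some R else \<sigma> i) = \<sigma>" and "p = q" by auto
  then show ?case by simp
next
  case (Suc n)
  then have "q < p" by auto
  then have "run \<sigma> p = run (\<sigma>(p := Some R)) (p - 1)"
    using Suc.prems by (subst run.simps) simp
  also have "\<dots> = run (\<lambda>i. if i \<in> {q<..p - 1} then Some R else (\<sigma>(p := Some R)) i) q"
    using Suc \<open>q < p\<close> by (intro Suc.hyps(1)) auto
  also have "(\<lambda>i. if i \<in> {q<..p - 1} then Some R else (\<sigma>(p := Some R)) i)
      = (\<lambda>i. if i \<in> {q<..p} then Some R else \<sigma> i)"
    using \<open>q < p\<close> by (intro ext) auto
  finally show ?case .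
qed

lemma run_unoccupied: "\<sigma> p = None \<Longrightarrow> run \<sigma> p = (\<sigma>, p)"
  by (subst run.simps) simp

text \<open>A particle that leaves to the right leaves labels \<open>L\<close> on all sites it has visited, up to the right
  end, so the final labelling is a triple state whose terminal block of \<open>R\<close> has length \<open>0\<close>.\<close>

definition exit_config :: "int \<Rightarrow> int \<times> int \<times> int \<Rightarrow> int \<Rightarrow> state \<times> int" where
  "exit_config s = (\<lambda>(x, y, z) p.
     if x + y \<le> p + z then (state_of 0 (x, y + s, p + z - y), y + s)
     else (state_of s (x, y, p + z - x + 1), x - 1))"

text \<open>While both ends are out of reach, the particle travels right to \<open>z\<close> and back to \<open>p - 1\<close>, which
  amounts to replacing \<open>(p, z)\<close> by \<open>(p - 1, z + 1)\<close>; so \<open>p + z\<close> alone decides where it exits.\<close>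

lemma run_excursions:
  assumes "s > 0" and "x - 1 \<le> p" and "p < z" and "z \<le> y"
  shows "run (state_of s (x, y, z)) p = exit_config s (x, y, z) p"
  using assms
proof (induction "nat (p - x + 1)" arbitrary: p z)
  case 0
  then have p: "p = x - 1" by simp
  \<comment> \<open>The particle already stands left of the interval; \<open>z \<le> y\<close>
    selects the left branch of \<open>exit_config\<close>.\<close>
  have "run (state_of s (x, y, z)) p = (state_of s (x, y, z), p)"
    using 0 p by (intro run_unoccupied) simp
  then show ?case using 0 p by (simp add: exit_config_def)
next
  case (Suc n)
  then have "x \<le> p" by simp
  show ?case
  proof (cases "z = y")
    case True
    have "run (state_of s (x, y, z)) p
        = run (\<lambda>i. if i \<in> {p..<y + s} then Some L else state_of s (x, y, z) i) (y + s)"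
      using Suc.prems \<open>x \<le> p\<close> True by (intro run_right) auto
    also have "(\<lambda>i. if i \<in> {p..<y + s} then Some L else state_of s (x, y, z) i)
        = state_of 0 (x, y + s, p)"
      using Suc.prems \<open>x \<le> p\<close> True by auto
    also have "run (state_of 0 (x, y + s, p)) (y + s) = (state_of 0 (x, y + s, p), y + s)"
      using Suc.prems by (intro run_unoccupied) simp
    finally show ?thesis using True \<open>x \<le> p\<close> by (simp add: exit_config_def)
  next
    case False
    have "run (state_of s (x, y, z)) p
        = run (\<lambda>i. if i \<in> {p..<z} then Some L else state_of s (x, y, z) i) z"
      using Suc.prems \<open>x \<le> p\<close> by (intro run_right) auto
    also have "\<dots> = run (\<lambda>i. if i \<in> {p - 1<..z} then Some R
        else (if i \<in> {p..<z} then Some L else state_of s (x, y, z) i)) (p - 1)"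
      using Suc.prems \<open>x \<le> p\<close> False by (intro run_left) auto
    also have "(\<lambda>i. if i \<in> {p - 1<..z} then Some R
        else (if i \<in> {p..<z} then Some L else state_of s (x, y, z) i)) = state_of s (x, y, z + 1)"
      using Suc.prems \<open>x \<le> p\<close> False by auto
    also have "run (state_of s (x, y, z + 1)) (p - 1) = exit_config s (x, y, z + 1) (p - 1)"
      using Suc False \<open>x \<le> p\<close> by (intro Suc.hyps(1)) auto
    finally show ?thesis by (simp add: exit_config_def)
  qed
qed

lemma run_state_of:
  assumes "s > 0" and "(x, y, z) \<in> Rec"
  shows "run (state_of s (x, y, z)) 0 = exit_config s (x, y, z) 0"
proof -
  have xyz: "x \<le> 0" "0 \<le> y" "x \<le> z" "z \<le> y" using assms(2) by (auto simp: Rec_def)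
  consider "0 < z" | "z \<le> 0" "y = 0" | "z \<le> 0" "0 < y" using xyz by linarith
  then show ?thesis
  proof cases
    case 1
    then show ?thesis using assms(1) xyz by (intro run_excursions) auto
  next
    \<comment> \<open>Site \<open>0\<close> opens the terminal block of \<open>R\<close>, so the
      particle leaves to the right at once.\<close>
    case 2
    have "run (state_of s (x, y, z)) 0
        = run (\<lambda>i. if i \<in> {0..<s} then Some L else state_of s (x, y, z) i) s"
      using assms(1) xyz 2 by (intro run_right) auto
    also have "(\<lambda>i. if i \<in> {0..<s} then Some L else state_of s (x, y, z) i) = state_of 0 (x, s, z)"
      using assms(1) xyz 2 by auto
    also have "run (state_of 0 (x, s, z)) s = (state_of 0 (x, s, z), s)"
      using assms(1) xyz 2 by (intro run_unoccupied) simp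
    finally show ?thesis using xyz 2 by (simp add: exit_config_def)
  next
    \<comment> \<open>The particle first slides left through the \<open>L\<close> labels on
      \<open>z..0\<close>. Afterwards \<open>(p, z)\<close> is \<open>(z - 1, 1)\<close>, with the
      same sum as the initial \<open>(0, z)\<close>.\<close>
    case 3
    have "run (state_of s (x, y, z)) 0
        = run (\<lambda>i. if i \<in> {z - 1<..0} then Some R else state_of s (x, y, z) i) (z - 1)"
      using xyz 3 by (intro run_left) auto
    also have "(\<lambda>i. if i \<in> {z - 1<..0} then Some R else state_of s (x, y, z) i) = state_of s (x, y, 1)"
      using xyz 3 by auto
    also have "run (state_of s (x, y, 1)) (z - 1) = exit_config s (x, y, 1) (z - 1)"
      using assms(1) xyz 3 by (intro run_excursions) auto
    finally show ?thesis by (simp add: exit_config_def)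
  qed
qed

fun step :: "int \<Rightarrow> int \<Rightarrow> int \<times> int \<times> int \<Rightarrow> int \<times> int \<times> int" where
  "step r s (x, y, z) = (if x + y \<le> z then (x, y + s, z - y) else (x - r, y, z - x + 1))"

lemma dom_state_of:
  assumes "s \<ge> 0" and "x \<le> z" and "z \<le> y"
  shows "dom (state_of s (x, y, z)) = {x..y + s - 1}"
  using assms by (auto simp: dom_def)

lemma rotor_map_state_of:
  assumes "r > 0" and "s > 0" and "\<sigma> \<in> Rec"
  shows "rotor_map r s (state_of s \<sigma>) = state_of s (step r s \<sigma>)"
proof -
  obtain x y z where \<sigma>: "\<sigma> = (x, y, z)" by (cases \<sigma>)
  have xyz: "x \<le> 0" "0 \<le> y" "x \<le> z" "z \<le> y" using assms(3) \<sigma> by (auto simp: Rec_def)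
  note run = run_state_of[OF assms(2) assms(3)[unfolded \<sigma>]]
  show ?thesis
  proof (cases "x + y \<le> z")
    case True
    have dom: "dom (state_of 0 (x, y + s, z - y)) = {x..y + s - 1}"
      using dom_state_of[of 0 x "z - y" "y + s"] assms(2) xyz True by simp
    have "rotor_map r s (state_of s \<sigma>) = occupy {y + s..y + s + s - 1} (state_of 0 (x, y + s, z - y))"
      unfolding rotor_map_def \<sigma> run exit_config_def using True by (simp add: dom del: state_of.simps)
    also have "\<dots> = state_of s (x, y + s, z - y)"
      using assms(2) xyz True by (auto simp: occupy_def)
    finally show ?thesis using True \<sigma> by simp
  next
    case False
    have dom: "dom (state_of s (x, y, z - x + 1)) = {x..y + s - 1}"
      using dom_state_of[of s x "z - x + 1" y] assms(2) xyz False by simp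
    have "\<not> (\<forall>q\<in>{x..y + s - 1}. q < x - 1)"
      using assms(2) xyz by force
    then have "rotor_map r s (state_of s \<sigma>) = occupy {x - r..x - 1} (state_of s (x, y, z - x + 1))"
      unfolding rotor_map_def \<sigma> run exit_config_def using False
      by (simp add: dom del: state_of.simps Ball_def)
    also have "\<dots> = state_of s (x - r, y, z - x + 1)"
      using assms xyz False by (auto simp: occupy_def)
    finally show ?thesis using False \<sigma> by simp
  qed
qed

lemma step_Rec:
  assumes "r > 0" and "s > 0" and "\<sigma> \<in> Rec"
  shows "step r s \<sigma> \<in> Rec"
  using assms by (cases \<sigma>) (auto simp: Rec_def)

lemma rotor_map_funpow_state_of:
  assumes "r > 0" and "s > 0" and "\<sigma> \<in> Rec"
  shows "(step r s ^^ k) \<sigma> \<in> Rec \<and>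
    (rotor_map r s ^^ k) (state_of s \<sigma>) = state_of s ((step r s ^^ k) \<sigma>)"
  using assms by (induction k) (auto simp: step_Rec rotor_map_state_of)

text \<open>Transfers equalities of states back to triples: the domain determines both ends, and
  \<open>z\<close> is where the \<open>R\<close> block starting at \<open>x\<close> stops.\<close>

lemma state_of_inject:
  assumes "s > 0" and "\<sigma> \<in> Rec" and "\<sigma>' \<in> Rec" and "state_of s \<sigma> = state_of s \<sigma>'"
  shows "\<sigma> = \<sigma>'"
proof -
  obtain x y z where \<sigma>: "\<sigma> = (x, y, z)" by (cases \<sigma>)
  obtain x' y' z' where \<sigma>': "\<sigma>' = (x', y', z')" by (cases \<sigma>')
  have le: "x \<le> 0" "0 \<le> y" "x \<le> z" "z \<le> y" "x' \<le> 0" "0 \<le> y'" "x' \<le> z'" "z' \<le> y'"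
    using assms(2,3) \<sigma> \<sigma>' by (auto simp: Rec_def)
  have "{x..y + s - 1} = {x'..y' + s - 1}"
    using dom_state_of[of s] assms(1,4) le \<sigma> \<sigma>' by (metis less_imp_le)
  then have xy: "x = x'" "y = y'" using le assms(1) by (auto simp: Icc_eq_Icc)
  have eq: "state_of s (x, y, z) q = state_of s (x, y, z') q" for q
    using assms(4) \<sigma> \<sigma>' xy by metis
  have "z = z'"
    \<comment> \<open>If they differed, the smaller of \<open>z\<close> and \<open>z'\<close> would
      carry \<open>L\<close> in one state and \<open>R\<close> in the other.\<close>
    using eq[of z] eq[of z'] le xy by (cases z z' rule: linorder_cases) auto
  then show ?thesis using xy \<sigma> \<sigma>' by simp
qed

section \<open>The invariant\<close>

text \<open>The terms in \<open>y\<close> change by \<open>- 2 * r * s * y\<close>, or those in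
  \<open>x\<close> by \<open>2 * r * s * (1 - x)\<close>; the change of \<open>z\<close> cancels
  this.\<close>

lemma g_step: "g r s (step r s \<sigma>) = g r s \<sigma>"
  by (cases \<sigma>) (simp add: power2_eq_square algebra_simps)

lemma g_funpow_step: "g r s ((step r s ^^ k) \<sigma>) = g r s \<sigma>"
  by (induction k) (auto simp: g_step)

lemma not_crossing:
  fixes r s :: int
  assumes "r > 0" and "s > 0" and "(x, y, z) \<in> Rec" and "(x', y', z') \<in> Rec"
    and "[x = x'] (mod r)" and "[y = y'] (mod s)"
    and "g r s (x, y, z) = g r s (x', y', z')"
  shows "\<not> (x' < x \<and> y' < y)"
proof
  assume lt: "x' < x \<and> y' < y"
  have bounds: "x \<le> 0" "0 \<le> y" "x \<le> z" "z \<le> y" "x' \<le> 0" "0 \<le> y'" "x' \<le> z'" "z' \<le> y'"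
    using assms(3,4) by (auto simp: Rec_def)
  have "r dvd x - x'" "s dvd y - y'" using assms(5,6) by (auto simp: cong_iff_dvd_diff)
  then have "r \<le> x - x'" "s \<le> y - y'" using lt by (auto intro: zdvd_imp_le)
  \<comment> \<open>These split \<open>g\<close> as
    \<open>A x - B y - 2 * r * s * z\<close>.\<close>
  define A where "A = (\<lambda>x. s * x\<^sup>2 + (r - 2) * s * x)"
  define B where "B = (\<lambda>y. r * y\<^sup>2 - r * s * y)"
  have "A x' - A (x - r) = s * ((x - r - x') * (2 - x - x'))"
    by (simp add: A_def power2_eq_square algebra_simps)
  moreover have "\<dots> \<ge> 0"
    using \<open>r \<le> x - x'\<close> bounds assms(2) by simp
  ultimately have A: "A (x - r) \<le> A x'" by linarith
  have "B y - B (y' + s) = r * ((y - y' - s) * (y + y'))"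
    by (simp add: B_def power2_eq_square algebra_simps)
  moreover have "\<dots> \<ge> 0"
    using \<open>s \<le> y - y'\<close> bounds assms(1) by simp
  ultimately have B: "B (y' + s) \<le> B y" by linarith
  \<comment> \<open>The left side exceeds \<open>g\<close> because \<open>x \<le> z\<close>; its
    counterpart for the other state is at most \<open>g\<close> because \<open>z' \<le> y'\<close>.
    The bounds on \<open>A\<close> and \<open>B\<close> order them the opposite way.\<close>
  have "A (x - r) - B y = g r s (x, y, z) + 2 * (r * s) * (z - x + 1)"
    by (simp add: A_def B_def power2_eq_square algebra_simps)
  moreover have "A x' - B (y' + s) = g r s (x', y', z') + 2 * (r * s) * (z' - y')"
    by (simp add: A_def B_def power2_eq_square algebra_simps)
  moreover have "2 * (r * s) * (z - x + 1) > 0"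
    using assms(1,2) bounds by simp
  moreover have "2 * (r * s) * (z' - y') \<le> 0"
    using assms(1,2) bounds by (intro mult_nonneg_nonpos) auto
  ultimately show False using A B assms(7) by linarith
qed

lemma reachable_by_step:
  fixes r s :: int
  assumes "r > 0" and "s > 0" and "(x, y, z) \<in> Rec" and "(x', y', z') \<in> Rec"
    and "[x = x'] (mod r)" and "[y = y'] (mod s)"
    and "g r s (x, y, z) = g r s (x', y', z')" and "x' \<le> x" and "y \<le> y'"
  shows "\<exists>k. (step r s ^^ k) (x, y, z) = (x', y', z')"
  using assms(3-)
proof (induction "nat ((x - x') + (y' - y))" arbitrary: x y z rule: less_induct)
  case less
  show ?case
  proof (cases "x = x' \<and> y = y'")
    case True
    \<comment> \<open>\<open>g\<close> is linear in \<open>z\<close> with nonzero coefficient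
      \<open>- 2 * r * s\<close>.\<close>
    then have "z = z'" using less.prems(5) assms(1,2) by simp
    then show ?thesis using True by (intro exI[of _ 0]) simp
  next
    case False
    obtain u v w where uvw: "step r s (x, y, z) = (u, v, w)"
      by (cases "step r s (x, y, z)")
    have Rec: "(u, v, w) \<in> Rec" using step_Rec[OF assms(1,2) less.prems(1)] uvw by simp
    have g: "g r s (u, v, w) = g r s (x', y', z')"
      using g_step[of r s "(x, y, z)"] uvw less.prems(5) by simp
    have cases: "u = x \<and> v = y + s \<or> u = x - r \<and> v = y"
      using uvw by (auto split: if_splits)
    then have cong: "[u = x'] (mod r)" "[v = y'] (mod s)"
      using less.prems(3,4) by (auto simp: cong_def)
    have dvd: "r dvd x - x'" "s dvd y' - y"
      using less.prems(3,4) by (auto simp: cong_iff_dvd_diff dvd_diff_commute)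
    have le: "x' \<le> u \<and> v \<le> y'"
    proof (rule ccontr)
      assume *: "\<not> (x' \<le> u \<and> v \<le> y')"
      \<comment> \<open>By divisibility a step overshoots only when the coordinate it moves already agrees;
        since the other one does not, the two states would then cross.\<close>
      have "x' < x \<Longrightarrow> r \<le> x - x'" "y < y' \<Longrightarrow> s \<le> y' - y"
        using dvd by (auto intro: zdvd_imp_le)
      then have "u < x' \<and> v < y' \<or> x' < u \<and> y' < v"
        using * cases False less.prems(6,7) assms(1,2) by smt
      then show False
        using not_crossing[OF assms(1,2) Rec less.prems(2) cong g]
          not_crossing[OF assms(1,2) less.prems(2) Rec cong(1)[THEN cong_sym]
            cong(2)[THEN cong_sym] g[symmetric]]
        by blast
    qed
    have "nat ((u - x') + (y' - v)) < nat ((x - x') + (y' - y))"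
      using cases le assms(1,2) by auto
    then obtain k where "(step r s ^^ k) (u, v, w) = (x', y', z')"
      using less.hyps[OF _ Rec less.prems(2) cong g] le by blast
    then have "(step r s ^^ Suc k) (x, y, z) = (x', y', z')"
      using uvw by (simp add: funpow_swap1 del: step.simps)
    then show ?thesis by blast
  qed
qed

theorem theorem2p9:
  fixes r s x y z x' y' z' :: int
  assumes "r > 0" and "s > 0"
    and "(x, y, z) \<in> Rec" and "(x', y', z') \<in> Rec"
    and "[x = x'] (mod r)" and "[y = y'] (mod s)"
  shows "(\<exists>k. (rotor_map r s ^^ k) (state_of s (x, y, z)) = state_of s (x', y', z') \<or>
              (rotor_map r s ^^ k) (state_of s (x', y', z')) = state_of s (x, y, z))
         \<longleftrightarrow> g r s (x, y, z) = g r s (x', y', z')"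
proof -
  have orbit: "(rotor_map r s ^^ k) (state_of s \<sigma>) = state_of s \<tau> \<longleftrightarrow> (step r s ^^ k) \<sigma> = \<tau>"
    if "\<sigma> \<in> Rec" and "\<tau> \<in> Rec" for k \<sigma> \<tau>
    using rotor_map_funpow_state_of[OF assms(1,2) that(1)] state_of_inject[OF assms(2) _ that(2)]
    by metis
  have "(\<exists>k. (step r s ^^ k) (x, y, z) = (x', y', z') \<or> (step r s ^^ k) (x', y', z') = (x, y, z))
      \<longleftrightarrow> g r s (x, y, z) = g r s (x', y', z')" (is "?lhs \<longleftrightarrow> ?rhs")
  proof
    show "?rhs" if "?lhs" using that g_funpow_step by metis
  next
    assume eq: "?rhs"
    note swap = assms(5)[THEN cong_sym] assms(6)[THEN cong_sym] eq[symmetric]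
    \<comment> \<open>Excluding a crossing in both orders leaves nested intervals; the inner state
      reaches the outer one.\<close>
    have "x' \<le> x \<and> y \<le> y' \<or> x \<le> x' \<and> y' \<le> y"
      using not_crossing[OF assms eq] not_crossing[OF assms(1,2,4,3) swap] by linarith
    then show "?lhs"
      using reachable_by_step[OF assms eq] reachable_by_step[OF assms(1,2,4,3) swap] by blast
  qed
  then show ?thesis
    by (simp only: orbit[OF assms(3,4)] orbit[OF assms(4,3)])
qed

end
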